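(* Let $n\ge 3$, let $K\subset\mathbb{R}^n$ be a convex body contained in the interior of the closed unit ball $\mathbb{B}^n$ centered at the origin, and let $p\in\mathbb{R}^n$. Suppose that for every $x\in\mathbb{S}^{n-1}$ the cone $C_x$ circumscribed to $K$ with apex $x$ is a symmetric cone and its axis $L_x$ passes through $p$. Then $K$ is a ball with center at $p$.
   Context: A convex body in $\mathbb{R}^n$ is a compact convex set with non-empty interior. $\mathbb{S}^{n-1}$ is the unit sphere centered at the origin. For $x\in\mathbb{R}^n\setminus K$, the solid cone generated by $K$ and $x$ is $\{x+\lambda(y-x) : y\in K,\ \lambda\ge 0\}$, and the cone $C_x$ circumscribed to $K$ with apex $x$ is the boundary of this solid cone. A convex cone $C$ with apex $x$ is a symmetric cone with axis $L_x$ if $L_x$ is a line through $x$ such that for every $2$-dimensional plane $\Gamma$ containing $L_x$, the line $L_x$ is the angle bisector of the angular region $\Gamma\cap C$. Saying that $C_x$ is a symmetric cone with axis $L_x$ means that the solid cone generated by $K$ and $x$ is a symmetric cone with axis $L_x$. *)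

theory Defs
  imports "HOL-Analysis.Analysis"
begin

definition convex_body :: "'a::euclidean_space set \<Rightarrow> bool" where
  "convex_body K \<longleftrightarrow> compact K \<and> convex K \<and> interior K \<noteq> {}"

definition solid_cone :: "'a::real_vector set \<Rightarrow> 'a \<Rightarrow> 'a set" where
  "solid_cone K x = {x + t *\<^sub>R (y - x) | y t. y \<in> K \<and> 0 \<le> t}"

definition vec_angle :: "'a::real_inner \<Rightarrow> 'a \<Rightarrow> real" where
  "vec_angle u v = arccos (u \<bullet> v / (norm u * norm v))"

definition angular_region :: "'a::real_vector \<Rightarrow> 'a \<Rightarrow> 'a \<Rightarrow> 'a set" where
  "angular_region x u v = {x + a *\<^sub>R u + b *\<^sub>R v | a b. 0 \<le> a \<and> 0 \<le> b}"

text \<open>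
  The directions \<open>u\<close> and \<open>v\<close> of the two sides of the region are linearly independent, so the
  opening angle lies strictly between \<open>0\<close> and \<open>pi\<close>. This is no restriction for sections of the
  solid cone of a compact convex set from an outside point, which contains no line. The condition
  that \<open>x + w\<close> lies in \<open>A\<close> selects the internal bisector.
\<close>

definition angle_bisector :: "'a::euclidean_space set \<Rightarrow> 'a \<Rightarrow> 'a set \<Rightarrow> bool" where
  "angle_bisector A x L \<longleftrightarrow>
     (\<exists>u v w. u \<noteq> v \<and> independent {u, v} \<and> A = angular_region x u v \<and>
        w \<noteq> 0 \<and> x + w \<in> A \<and> vec_angle u w = vec_angle w v \<and>
        L = {x + t *\<^sub>R w | t. True})"

definition symmetric_cone :: "'a::euclidean_space set \<Rightarrow> 'a \<Rightarrow> 'a set \<Rightarrow> bool" where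
  "symmetric_cone C x L \<longleftrightarrow>
     convex_cone ((\<lambda>y. y - x) ` C) \<and>
     affine L \<and> aff_dim L = 1 \<and> x \<in> L \<and>
     (\<forall>\<Gamma>. affine \<Gamma> \<and> aff_dim \<Gamma> = 2 \<and> L \<subseteq> \<Gamma> \<longrightarrow> angle_bisector (\<Gamma> \<inter> C) x L)"

text \<open>
  The circumscribed cone is the hypersurface \<open>frontier (solid_cone K x)\<close>; its symmetry is by
  convention that of the solid cone.
\<close>

definition circumscribed_cone_symmetric :: "'a::euclidean_space set \<Rightarrow> 'a \<Rightarrow> 'a set \<Rightarrow> bool" where
  "circumscribed_cone_symmetric K x L \<longleftrightarrow> symmetric_cone (solid_cone K x) x L"

end

theory Submission
  imports Defs
begin

text \<open>
  Let \<open>d\<close> be the largest distance from \<open>p\<close> to a point of \<open>K\<close>, and let \<open>M\<close> be the closed set of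
  unit vectors \<open>u\<close> with \<open>p + d *\<^sub>R u \<in> K\<close>. For \<open>u \<in> M\<close> the hyperplane through
  \<open>p + d *\<^sub>R u\<close> normal to \<open>u\<close> supports \<open>K\<close>; if \<open>x\<close> is a point of the unit sphere on it, the
  reflection in the line through \<open>x\<close> and \<open>p\<close> preserves the cone at \<open>x\<close> and \<open>cball p d\<close>, which
  forces the image of \<open>p + d *\<^sub>R u\<close> to be in \<open>K\<close> again. So \<open>M\<close> contains with \<open>u\<close> a whole sphere
  \<open>W u\<close> of codimension one around \<open>u\<close>, and \<open>w \<in> W u\<close> iff \<open>u \<in> W w\<close>. If \<open>v\<close> were not in
  \<open>M\<close>, let \<open>u\<close> be a point of \<open>M\<close> nearest to \<open>v\<close>: every \<open>W w\<close> with \<open>w \<in> W u\<close> would be tangent at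
  \<open>u\<close> to the same cap, and in dimension at least three there are too many such \<open>w\<close>.
\<close>

section \<open>Reflections in lines and symmetric cones\<close>

text \<open>This fixes the line spanned by \<open>s\<close> and is minus the identity on its
  orthogonal complement, unlike a Householder reflection.\<close>

definition reflect_in :: "'a::real_inner \<Rightarrow> 'a \<Rightarrow> 'a" where
  "reflect_in s z = (2 * (z \<bullet> s) / (s \<bullet> s)) *\<^sub>R s - z"

lemma reflect_in_scaleR: "k \<noteq> 0 \<Longrightarrow> reflect_in (k *\<^sub>R s) z = reflect_in s z"
  by (simp add: reflect_in_def)

lemma reflect_in_self_scaleR: "reflect_in s (k *\<^sub>R s) = k *\<^sub>R s"
  by (cases "s = 0") (simp_all add: reflect_in_def scaleR_left_diff_distrib [symmetric])

lemma reflect_in_linear: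
  "reflect_in s (a *\<^sub>R y + b *\<^sub>R z) = a *\<^sub>R reflect_in s y + b *\<^sub>R reflect_in s z"
  by (simp add: reflect_in_def algebra_simps add_divide_distrib)

text \<open>The diagonal \<open>u + w\<close> of a rhombus is an axis of symmetry: equal norms make
  the coefficient in \<open>reflect_in\<close> equal to 1.\<close>

lemma reflect_in_add_swap:
  assumes "norm u = norm w" "u + w \<noteq> 0"
  shows "reflect_in (u + w) u = w"
proof -
  have "(u + w) \<bullet> (u + w) = 2 * (u \<bullet> (u + w))"
    using assms(1) by (simp add: inner_add norm_eq inner_commute)
  moreover have "(u + w) \<bullet> (u + w) \<noteq> 0"
    using assms(2) by simp
  ultimately have "2 * (u \<bullet> (u + w)) / ((u + w) \<bullet> (u + w)) = 1"
    by (metis divide_self)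
  then show ?thesis unfolding reflect_in_def by (metis add_diff_cancel_left' scaleR_one)
qed

text \<open>Equal angles make \<open>w\<close> orthogonal to \<open>sgn u - sgn v\<close>; inside
  the plane of \<open>u\<close> and \<open>v\<close> this leaves only the direction
  \<open>sgn u + sgn v\<close>.\<close>

lemma equal_angles_imp_bisector:
  fixes u v w :: "'a::euclidean_space"
  assumes ind: "independent {u, v}" and "u \<noteq> v" and "w \<noteq> 0"
    and w: "w = a *\<^sub>R u + b *\<^sub>R v" and ang: "vec_angle u w = vec_angle w v"
  obtains k where "k \<noteq> 0" "w = k *\<^sub>R (sgn u + sgn v)"
proof -
  have nz: "u \<noteq> 0" "v \<noteq> 0"
    using ind dependent_zero by blast+
  \<comment> \<open>\<open>arccos\<close> can be cancelled only on arguments in [-1, 1].\<close>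
  have bound: "\<bar>y \<bullet> z / (norm y * norm z)\<bar> \<le> 1" for y z :: 'a
    using Cauchy_Schwarz_ineq2[of y z] by (cases "y = 0 \<or> z = 0") (auto simp: divide_le_eq)
  have "u \<bullet> w / (norm u * norm w) = w \<bullet> v / (norm w * norm v)"
    using ang bound arccos_eq_iff unfolding vec_angle_def by blast
  then have eq: "sgn u \<bullet> w = sgn v \<bullet> w"
    using nz \<open>w \<noteq> 0\<close> by (simp add: sgn_div_norm field_simps inner_commute)
  define s where "s = sgn u \<bullet> sgn v"
  have un: "u = norm u *\<^sub>R sgn u" and vn: "v = norm v *\<^sub>R sgn v"
    using nz by (simp_all add: sgn_div_norm)
  define \<alpha> \<beta> where "\<alpha> = a * norm u" and "\<beta> = b * norm v"
  have w': "w = \<alpha> *\<^sub>R sgn u + \<beta> *\<^sub>R sgn v"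
    unfolding w \<alpha>_def \<beta>_def by (metis scaleR_scaleR un vn)
  have one: "sgn u \<bullet> sgn u = 1" "sgn v \<bullet> sgn v = 1"
    using nz by (simp_all add: dot_square_norm norm_sgn)
  have "s \<noteq> 1"
  proof
    assume "s = 1"
    then have "(sgn u - sgn v) \<bullet> (sgn u - sgn v) = 0"
      using one by (simp add: s_def inner_diff inner_commute)
    then have "sgn u = sgn v" by simp
    then have "u = (norm u / norm v) *\<^sub>R v"
      using nz un vn by (metis divide_inverse scaleR_scaleR sgn_div_norm)
    then have "u \<in> span {v}"
      by (metis span_base span_scale singletonI)
    then show False
      using ind \<open>u \<noteq> v\<close> by (simp add: independent_insert)
  qed
  have "\<alpha> + \<beta> * s = \<alpha> * s + \<beta>"
    using eq one unfolding w' by (simp add: inner_add s_def inner_commute)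
  then have "(\<alpha> - \<beta>) * (1 - s) = 0" by (simp add: algebra_simps)
  with \<open>s \<noteq> 1\<close> have "\<alpha> = \<beta>" by simp
  then have "w = \<alpha> *\<^sub>R (sgn u + sgn v)"
    using w' by (simp add: scaleR_add_right)
  moreover from this have "\<alpha> \<noteq> 0" using \<open>w \<noteq> 0\<close> by auto
  ultimately show ?thesis using that by blast
qed

text \<open>The reflection exchanges the unit vectors along the two sides, so nonnegative
  coefficients stay nonnegative after rescaling by the norms.\<close>

lemma angular_region_reflect:
  fixes x :: "'a::euclidean_space"
  assumes "angle_bisector A x L" "p \<in> L" "p \<noteq> x" "y \<in> A"
  shows "x + reflect_in (p - x) (y - x) \<in> A"
proof -
  obtain u v w where uv: "u \<noteq> v" "independent {u, v}" and A: "A = angular_region x u v"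
    and w: "w \<noteq> 0" "x + w \<in> A" "vec_angle u w = vec_angle w v"
    and L: "L = {x + t *\<^sub>R w | t. True}"
    using assms(1) unfolding angle_bisector_def by blast
  obtain a b where "w = a *\<^sub>R u + b *\<^sub>R v"
    using w(2) unfolding A angular_region_def by (auto simp: add.assoc)
  then obtain k where k: "k \<noteq> 0" "w = k *\<^sub>R (sgn u + sgn v)"
    using equal_angles_imp_bisector uv w by metis
  obtain t where t: "p = x + t *\<^sub>R w" using assms(2) L by auto
  have nz: "u \<noteq> 0" "v \<noteq> 0"
    using uv(2) dependent_zero by blast+
  have sum0: "sgn u + sgn v \<noteq> 0" using k w(1) by auto
  have r: "reflect_in (p - x) = reflect_in (sgn u + sgn v)"
    using t assms(3) k by (auto simp: reflect_in_scaleR)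
  have ru: "reflect_in (p - x) (sgn u) = sgn v" "reflect_in (p - x) (sgn v) = sgn u"
    unfolding r using reflect_in_add_swap[of "sgn u" "sgn v"] reflect_in_add_swap[of "sgn v" "sgn u"]
      sum0 nz by (simp_all add: norm_sgn add.commute)
  obtain a' b' where ab: "0 \<le> a'" "0 \<le> b'" "y = x + a' *\<^sub>R u + b' *\<^sub>R v"
    using assms(4) unfolding A angular_region_def by auto
  have "y - x = (a' * norm u) *\<^sub>R sgn u + (b' * norm v) *\<^sub>R sgn v"
    using ab nz by (simp add: sgn_div_norm mult.assoc)
  then have "reflect_in (p - x) (y - x) = (a' * norm u) *\<^sub>R sgn v + (b' * norm v) *\<^sub>R sgn u"
    by (simp add: reflect_in_linear ru)
  also have "\<dots> = (b' * norm v / norm u) *\<^sub>R u + (a' * norm u / norm v) *\<^sub>R v"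
    by (simp add: sgn_div_norm divide_inverse add.commute)
  finally have "x + reflect_in (p - x) (y - x)
      = x + (b' * norm v / norm u) *\<^sub>R u + (a' * norm u / norm v) *\<^sub>R v"
    by (simp add: add.assoc)
  then show ?thesis
    unfolding A angular_region_def using ab(1,2)
    by (intro CollectI exI[of _ "b' * norm v / norm u"] exI[of _ "a' * norm u / norm v"]) simp
qed

text \<open>A point off the axis spans with it a plane, where the planar case applies; points of the
  axis are fixed.\<close>

lemma symmetric_cone_reflect:
  fixes x :: "'a::euclidean_space"
  assumes "symmetric_cone C x L" "p \<in> L" "p \<noteq> x" "y \<in> C"
  shows "x + reflect_in (p - x) (y - x) \<in> C"
proof -
  have L: "affine L" "aff_dim L = 1" "x \<in> L"
    and bis: "\<And>\<Gamma>. affine \<Gamma> \<Longrightarrow> aff_dim \<Gamma> = 2 \<Longrightarrow> L \<subseteq> \<Gamma> \<Longrightarrow> angle_bisector (\<Gamma> \<inter> C) x L"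
    using assms(1) unfolding symmetric_cone_def by auto
  have hull: "affine hull {x, p} = L"
  proof (rule affine_dim_equal)
    show "aff_dim (affine hull {x, p}) = aff_dim L"
      using L assms(3) by (simp add: aff_dim_affine_hull aff_dim_2)
    show "affine hull {x, p} \<subseteq> L"
      using L assms(2) by (simp add: hull_minimal)
  qed (use L in auto)
  show ?thesis
  proof (cases "y \<in> L")
    case True
    then obtain t where "y = x + t *\<^sub>R (p - x)"
      unfolding hull [symmetric] affine_hull_2_alt by auto
    then show ?thesis using assms(4) by (simp add: reflect_in_self_scaleR)
  next
    case False
    define \<Gamma> where "\<Gamma> = affine hull (insert y {x, p})"
    have "aff_dim \<Gamma> = 2"
      unfolding \<Gamma>_def aff_dim_affine_hull using False hull assms(3)
      by (subst aff_dim_insert) (simp add: aff_dim_2)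
    moreover have "L \<subseteq> \<Gamma>"
      unfolding \<Gamma>_def hull [symmetric] by (rule hull_mono) auto
    ultimately have "angle_bisector (\<Gamma> \<inter> C) x L"
      by (intro bis) (simp_all add: \<Gamma>_def)
    moreover have "y \<in> \<Gamma>" unfolding \<Gamma>_def by (rule hull_inc) simp
    ultimately show ?thesis
      using angular_region_reflect assms(2-4) by blast
  qed
qed

section \<open>Hyperplane sections of the unit sphere\<close>

text \<open>A Lagrange multiplier rule without calculus: comparison with an explicit competitor
  gives equality in Cauchy-Schwarz for the components of \<open>u\<close> and \<open>v\<close>
  orthogonal to \<open>N\<close>.\<close>

lemma sphere_section_maximum:
  fixes u v N :: "'a::real_inner"
  assumes "norm u = 1" and lt: "\<bar>N \<bullet> u\<bar> < norm N"
    and max: "\<And>z. norm z = 1 \<Longrightarrow> N \<bullet> z = N \<bullet> u \<Longrightarrow> v \<bullet> z \<le> v \<bullet> u"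
  obtains \<alpha> \<beta> where "v = \<alpha> *\<^sub>R u + \<beta> *\<^sub>R N"
proof -
  have NN: "N \<bullet> N > 0" using lt by force
  define m where "m = (N \<bullet> u) / (N \<bullet> N)"
  define l where "l = (N \<bullet> v) / (N \<bullet> N)"
  define u' where "u' = u - m *\<^sub>R N"
  define v' where "v' = v - l *\<^sub>R N"
  have ou: "N \<bullet> u' = 0" and ov: "N \<bullet> v' = 0"
    using NN by (simp_all add: u'_def v'_def m_def l_def inner_diff_right)
  have u: "u = m *\<^sub>R N + u'" and v: "v = l *\<^sub>R N + v'"
    by (simp_all add: u'_def v'_def)
  have one: "m\<^sup>2 * (N \<bullet> N) + u' \<bullet> u' = 1"
    using \<open>norm u = 1\<close> ou unfolding norm_eq_1
    by (subst (asm) (1 2) u) (simp add: inner_add inner_commute power2_eq_square)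
  have "u' \<noteq> 0"
  proof
    assume "u' = 0"
    then have "u = m *\<^sub>R N" using u by simp
    then have "\<bar>N \<bullet> u\<bar> = \<bar>m\<bar> * norm N * norm N" "\<bar>m\<bar> * norm N = 1"
      using \<open>norm u = 1\<close> by (auto simp: abs_mult dot_square_norm power2_eq_square)
    then show False using lt by simp
  qed
  show ?thesis
  proof (cases "v' = 0")
    case True
    then show ?thesis using that[of 0 l] v by simp
  next
    case False
    \<comment> \<open>The point of the section lying from its center in the direction
      \<open>v'\<close>; the section has radius \<open>norm u'\<close>.\<close>
    define z where "z = m *\<^sub>R N + (norm u' / norm v') *\<^sub>R v'"
    have "z \<bullet> z = m\<^sup>2 * (N \<bullet> N) + (norm u' / norm v')\<^sup>2 * (v' \<bullet> v')"
      using ov by (simp add: z_def inner_add inner_commute power2_eq_square)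
    also have "(norm u' / norm v')\<^sup>2 * (v' \<bullet> v') = u' \<bullet> u'"
      using False by (simp add: power_divide dot_square_norm)
    finally have "norm z = 1" using one by (simp add: norm_eq_1)
    moreover have "N \<bullet> z = N \<bullet> u"
      using ou ov NN by (simp add: z_def m_def inner_add)
    ultimately have "v \<bullet> z \<le> v \<bullet> u" by (rule max)
    moreover have "v \<bullet> z = l * m * (N \<bullet> N) + norm u' * norm v'"
      unfolding z_def using ov False
      by (subst v) (simp add: inner_add inner_commute dot_square_norm power2_eq_square)
    moreover have "v \<bullet> u = l * m * (N \<bullet> N) + v' \<bullet> u'"
      using ou ov by (subst u, subst v) (simp add: inner_add inner_commute)
    ultimately have "norm v' * norm u' \<le> v' \<bullet> u'" by (simp add: mult.commute)
    then have "v' \<bullet> u' = norm v' * norm u'"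
      using norm_cauchy_schwarz[of v' u'] by simp
    then have "norm v' *\<^sub>R u' = norm u' *\<^sub>R v'"
      using norm_cauchy_schwarz_eq by blast
    then have "inverse (norm u') *\<^sub>R norm v' *\<^sub>R u' = inverse (norm u') *\<^sub>R norm u' *\<^sub>R v'"
      by simp
    then have "v' = (norm v' / norm u') *\<^sub>R u'"
      using \<open>u' \<noteq> 0\<close> by (simp add: divide_inverse mult.commute)
    then have "v = (norm v' / norm u') *\<^sub>R u + (l - norm v' / norm u' * m) *\<^sub>R N"
      using v by (simp add: u'_def algebra_simps)
    then show ?thesis using that by blast
  qed
qed

text \<open>The multiple of \<open>N\<close> is the center of the section and \<open>R\<close> its
  radius, by Pythagoras.\<close>

lemma sphere_section_point:
  fixes N g :: "'a::real_inner"
  assumes "\<bar>m\<bar> < norm N" "norm g = 1" "N \<bullet> g = 0"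
  defines "R \<equiv> sqrt (1 - (m / norm N)\<^sup>2)"
  shows "norm ((m / (N \<bullet> N)) *\<^sub>R N + R *\<^sub>R g) = 1"
    and "N \<bullet> ((m / (N \<bullet> N)) *\<^sub>R N + R *\<^sub>R g) = m"
    and "R > 0"
proof -
  have N: "norm N > 0" using assms(1) by linarith
  have "\<bar>m / norm N\<bar> < 1" using assms(1) N by simp
  then have lt: "(m / norm N)\<^sup>2 < 1" using abs_square_less_1 by blast
  then show "R > 0" by (simp add: R_def)
  have R2: "R\<^sup>2 = 1 - (m / norm N)\<^sup>2" using lt by (simp add: R_def)
  have gg: "g \<bullet> g = 1" using assms(2) by (simp add: norm_eq_1)
  show "N \<bullet> ((m / (N \<bullet> N)) *\<^sub>R N + R *\<^sub>R g) = m"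
    using N assms(3) by (simp add: inner_add)
  have "((m / (N \<bullet> N)) *\<^sub>R N + R *\<^sub>R g) \<bullet> ((m / (N \<bullet> N)) *\<^sub>R N + R *\<^sub>R g)
      = (m / (N \<bullet> N))\<^sup>2 * (N \<bullet> N) + R\<^sup>2"
    using assms(3) gg by (simp add: inner_add inner_commute power2_eq_square)
  also have "(m / (N \<bullet> N))\<^sup>2 * (N \<bullet> N) = (m / norm N)\<^sup>2"
    using N by (simp add: dot_square_norm power2_eq_square field_simps)
  finally show "norm ((m / (N \<bullet> N)) *\<^sub>R N + R *\<^sub>R g) = 1"
    using R2 by (simp add: norm_eq_1)
qed

section \<open>The linking form\<close>

text \<open>
  For unit vectors \<open>u \<noteq> - w\<close> the hyperplanes tangent to \<open>cball p d\<close> with normals \<open>u\<close> and \<open>w\<close>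
  are exchanged by the reflection in the line from \<open>p\<close> to
  \<open>p + (d / (1 + u \<bullet> w)) *\<^sub>R (u + w)\<close>; this form vanishes iff that point lies on the unit sphere.
\<close>

definition linking_form :: "'a::real_inner \<Rightarrow> real \<Rightarrow> 'a \<Rightarrow> 'a \<Rightarrow> real" where
  "linking_form p d u w = 2 * d\<^sup>2 + 2 * d * (p \<bullet> (u + w)) - (1 - p \<bullet> p) * (1 + u \<bullet> w)"

lemma linking_form_commute: "linking_form p d u w = linking_form p d w u"
  by (simp add: linking_form_def inner_commute add.commute)

text \<open>For fixed \<open>u\<close> the zero set is cut out of the sphere by a hyperplane; this
  section is the set \<open>W u\<close> of the outline.\<close>

lemma linking_form_affine:
  "linking_form p d u w =
     ((2 * d) *\<^sub>R p - (1 - p \<bullet> p) *\<^sub>R u) \<bullet> w + (2 * d\<^sup>2 + 2 * d * (p \<bullet> u) - (1 - p \<bullet> p))"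
  by (simp add: linking_form_def algebra_simps inner_add inner_diff)

text \<open>The sign tells whether the contact point lies inside the unit ball.\<close>

lemma linking_form_diag:
  "norm u = 1 \<Longrightarrow> linking_form p d u u = 2 * ((norm (p + d *\<^sub>R u))\<^sup>2 - 1)"
  unfolding power2_norm_eq_inner
  by (simp add: linking_form_def norm_eq_1 inner_add inner_commute algebra_simps power2_eq_square)

lemma linking_form_antidiag: "norm u = 1 \<Longrightarrow> linking_form p d u (- u) = 2 * d\<^sup>2"
  by (simp add: linking_form_def norm_eq_1)

section \<open>The extremal argument on the sphere of directions\<close>

lemma linking_closed_eq_sphere:
  fixes M :: "'a::euclidean_space set"
  assumes dim: "DIM('a) \<ge> 3" and "d \<noteq> 0" and "closed M" and M1: "M \<subseteq> sphere 0 1" and "M \<noteq> {}"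
    and diag: "\<And>u. u \<in> M \<Longrightarrow> linking_form p d u u < 0"
    and step: "\<And>u w. u \<in> M \<Longrightarrow> norm w = 1 \<Longrightarrow> linking_form p d u w = 0 \<Longrightarrow> w \<in> M"
  shows "M = sphere 0 1"
proof (rule ccontr)
  assume "M \<noteq> sphere 0 1"
  then obtain v where "v \<in> sphere 0 1" and vM: "v \<notin> M" using M1 by blast
  then have v: "norm v = 1" "v \<notin> M" by simp_all
  have "compact M"
    using \<open>closed M\<close> M1 compact_sphere closed_Int_compact by (metis inf.absorb1)
  \<comment> \<open>For unit vectors, a larger inner product with \<open>v\<close> means a smaller
    distance to \<open>v\<close>.\<close>
  then obtain u where u: "u \<in> M" and umax: "\<And>z. z \<in> M \<Longrightarrow> v \<bullet> z \<le> v \<bullet> u"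
    using continuous_attains_sup[OF _ \<open>M \<noteq> {}\<close>
        continuous_on_inner[OF continuous_on_const[of M v] continuous_on_id]] by blast
  have M_norm: "norm z = 1" if "z \<in> M" for z using that M1 by auto
  define A where "A = 1 - p \<bullet> p"
  define N where "N = (\<lambda>z. (2 * d) *\<^sub>R p - A *\<^sub>R z)"
  define m where "m = (\<lambda>z. A - 2 * d\<^sup>2 - 2 * d * (p \<bullet> z))"
  have form: "linking_form p d z w = N z \<bullet> w - m z" for z w
    by (simp add: linking_form_affine N_def m_def A_def)
  \<comment> \<open>The form is negative at \<open>z\<close> and positive at \<open>- z\<close>, so
    its hyperplane separates them and cuts the sphere in a section of positive radius.\<close>
  have neg: "N z \<bullet> z < m z" "N z \<bullet> (- z) > m z" if "z \<in> M" for z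
    using diag[OF that] linking_form_antidiag[OF M_norm[OF that], of p d] form[of z z]
      form[of z "- z"] zero_less_power2[of d] \<open>d \<noteq> 0\<close>
    by linarith+
  have ltN: "\<bar>m z\<bar> < norm (N z)" if "z \<in> M" for z
    using neg[OF that] M_norm[OF that] Cauchy_Schwarz_ineq2[of "N z" z] by auto
  define W where "W = {w. norm w = 1 \<and> N u \<bullet> w = m u}"
  have WM: "W \<subseteq> M" using step[OF u] form by (auto simp: W_def)
  define R where "R = sqrt (1 - (m u / norm (N u))\<^sup>2)"
  define c where "c = (m u / (N u \<bullet> N u)) *\<^sub>R N u"
  have sec: "c + R *\<^sub>R g \<in> W" if "norm g = 1" "N u \<bullet> g = 0" for g
    using sphere_section_point[OF ltN[OF u] that] by (simp add: W_def R_def c_def)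
  have dimN: "dim {g. N u \<bullet> g = 0} = DIM('a) - 1"
    using ltN[OF u] by (intro dim_hyperplane) auto
  have "\<exists>g. norm g = 1 \<and> N u \<bullet> g = 0"
  proof -
    have "\<not> {g. N u \<bullet> g = 0} \<subseteq> {0}"
      using dimN dim by (metis add_leE diff_is_0_eq dim_eq_0 not_numeral_le_zero numeral_le_one_iff order_trans semiring_norm(70))
    then obtain g where "N u \<bullet> g = 0" "g \<noteq> 0" by auto
    then show ?thesis by (intro exI[of _ "sgn g"]) (simp add: norm_sgn sgn_div_norm)
  qed
  then obtain g0 where g0: "norm g0 = 1" "N u \<bullet> g0 = 0" by blast
  have Rpos: "R > 0"
    using sphere_section_point(3)[OF ltN[OF u] g0] by (simp add: R_def)
  define w where "w = c + R *\<^sub>R g0"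
  have w: "w \<in> W" unfolding w_def by (rule sec[OF g0])
  have uu: "u \<bullet> u = 1" "w \<bullet> w = 1"
    using w M_norm[OF u] by (simp_all add: W_def norm_eq_1)
  have "w \<noteq> u" using w neg[OF u] by (auto simp: W_def)
  \<comment> \<open>This places \<open>p\<close> in the open unit ball. The second difference of the
    form is \<open>- A\<close> times a squared distance, and it is negative because the mixed value
    is 0 and both diagonal values are negative.\<close>
  have "A > 0"
  proof -
    have "linking_form p d u u + linking_form p d w w - 2 * linking_form p d u w
        = - (A * ((u - w) \<bullet> (u - w)))"
      using uu by (simp add: linking_form_def A_def inner_add inner_diff inner_commute algebra_simps)
    moreover have "linking_form p d u w = 0" using w by (simp add: W_def form)
    ultimately have "A * ((u - w) \<bullet> (u - w)) > 0"
      using diag[OF u] diag[of w] w WM by auto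
    then show ?thesis by (metis inner_ge_zero not_less zero_less_mult_iff)
  qed
  have vneq: "v \<noteq> u" "v \<noteq> - u"
  proof -
    show "v \<noteq> u" using u v by auto
    \<comment> \<open>If \<open>v = - u\<close>, maximality of \<open>u\<close> would leave
      \<open>u\<close> as the only point of \<open>M\<close>, but \<open>w\<close> is
      another.\<close>
    show "v \<noteq> - u"
    proof
      assume "v = - u"
      then have "u \<bullet> u \<le> u \<bullet> w" using w umax[of w] WM \<open>v = - u\<close> by (auto simp: inner_minus_left)
      then have "(u - w) \<bullet> (u - w) \<le> 0"
        using uu by (simp add: inner_diff inner_commute)
      then have "u - w = 0" by (metis inner_eq_zero_iff inner_ge_zero order_antisym)
      then have "u = w" by simp
      with \<open>w \<noteq> u\<close> show False by simp
    qed
  qed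
  text \<open>
    Since \<open>u\<close> is a point of \<open>M\<close> closest to \<open>v\<close>, each sphere \<open>linking_form p d w z = 0\<close> through
    \<open>u\<close> is tangent at \<open>u\<close> to the cap around \<open>v\<close>.
  \<close>
  have Nspan: "N w \<in> span {u, v}" if w: "w \<in> W" for w
  proof -
    have wM: "w \<in> M" using w WM by blast
    have "linking_form p d w u = 0"
      using w form[of u w] linking_form_commute[of p d w u] by (simp add: W_def)
    then have mw: "N w \<bullet> u = m w" by (simp add: form)
    obtain \<alpha> \<beta> where ab: "v = \<alpha> *\<^sub>R u + \<beta> *\<^sub>R N w"
    proof (rule sphere_section_maximum[of u "N w" v])
      fix z assume "norm z = 1" "N w \<bullet> z = N w \<bullet> u"
      then have "z \<in> M" using step[OF wM] mw by (simp add: form)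
      then show "v \<bullet> z \<le> v \<bullet> u" by (rule umax)
    qed (use ltN[OF wM] mw M_norm[OF u] in auto)
    have "\<beta> \<noteq> 0"
    proof
      assume "\<beta> = 0"
      then have "v = \<alpha> *\<^sub>R u" using ab by simp
      moreover from this have "\<bar>\<alpha>\<bar> = 1" using v M_norm[OF u] by simp
      ultimately show False using vneq by (auto simp: abs_if split: if_splits)
    qed
    then have "N w = (1 / \<beta>) *\<^sub>R (v - \<alpha> *\<^sub>R u)" using ab by simp
    then show ?thesis by (simp add: span_base span_diff span_scale)
  qed
  have "g \<in> span {u, v}" if g: "N u \<bullet> g = 0" for g
  proof (cases "g = 0")
    case True
    then show ?thesis by (simp add: span_zero)
  next
    case False
    define h where "h = sgn g"
    have h: "norm h = 1" "N u \<bullet> h = 0" using g False by (simp_all add: h_def norm_sgn sgn_div_norm)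
    \<comment> \<open>For antipodal points of \<open>W\<close> the terms in \<open>p\<close> and
      \<open>c\<close> cancel in the difference of the normals, leaving a multiple of
      \<open>h\<close>.\<close>
    then have "N (c + R *\<^sub>R (- h)) - N (c + R *\<^sub>R h) \<in> span {u, v}"
      by (intro span_diff Nspan sec) simp_all
    also have "N (c + R *\<^sub>R (- h)) - N (c + R *\<^sub>R h) = (2 * A * R) *\<^sub>R h"
      using scaleR_add_left[of "A * R" "A * R" h] by (simp add: N_def algebra_simps)
    also have "\<dots> = (2 * A * R / norm g) *\<^sub>R g"
      by (simp add: h_def sgn_div_norm divide_inverse)
    finally have "(norm g / (2 * A * R)) *\<^sub>R ((2 * A * R / norm g) *\<^sub>R g) \<in> span {u, v}"
      by (rule span_scale)
    then show ?thesis using False \<open>A > 0\<close> Rpos by simp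
  qed
  then have sub: "{g. N u \<bullet> g = 0} \<subseteq> span {u, v}" by blast
  have "dim (span {u, v}) \<le> 2"
    using dim_le_card'[of "{u, v}"] by (simp add: dim_span card_insert_if split: if_splits)
  then have "{g. N u \<bullet> g = 0} = span {u, v}"
    using dimN dim sub
    by (intro subspace_dim_equal) (auto intro: subspace_hyperplane subspace_span)
  \<comment> \<open>The dimension count alone does not exclude dimension 3. The contradiction is
    that \<open>neg\<close> puts \<open>m u\<close> strictly between \<open>N u \<bullet> u\<close>
    and its negative, which are now both 0.\<close>
  then have "N u \<bullet> u = 0" using span_base[of u "{u, v}"] by blast
  then show False using neg[OF u] by simp
qed

section \<open>Tangent hyperplanes and contact points\<close>

text \<open>A ball meets a tangent hyperplane only at the point of contact.\<close>

lemma norm_le_inner_imp_eq: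
  fixes z w :: "'a::real_inner"
  assumes "norm w = 1" "z \<bullet> w = d" "norm z \<le> d"
  shows "z = d *\<^sub>R w"
proof -
  have "(z - d *\<^sub>R w) \<bullet> (z - d *\<^sub>R w) = z \<bullet> z - d\<^sup>2"
    using assms(1,2) by (simp add: inner_diff inner_commute norm_eq_1 power2_eq_square)
  also have "\<dots> \<le> 0"
    using assms(3) by (simp add: dot_square_norm power_mono)
  finally have "z - d *\<^sub>R w = 0" by (metis inner_eq_zero_iff inner_ge_zero order_antisym)
  then show ?thesis by simp
qed

text \<open>The reflected ray stays in the solid cone, so it carries a point of \<open>K\<close>; it
  also lies in the tangent hyperplane with normal \<open>w\<close>, where \<open>cball p d\<close>
  has only its contact point.\<close>

lemma linked_contact_point:
  fixes K :: "'a::euclidean_space set"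
  assumes "d > 0" and K1: "K \<subseteq> ball 0 1" and Kd: "K \<subseteq> cball p d"
    and sym: "\<And>x. x \<in> sphere 0 1 \<Longrightarrow> \<exists>L. circumscribed_cone_symmetric K x L \<and> p \<in> L"
    and u: "norm u = 1" "p + d *\<^sub>R u \<in> K" and w: "norm w = 1" and link: "linking_form p d u w = 0"
  shows "p + d *\<^sub>R w \<in> K"
proof -
  have uu: "u \<bullet> u = 1" "w \<bullet> w = 1" using u w by (simp_all add: norm_eq_1)
  define s where "s = u + w"
  define e where "e = 1 + u \<bullet> w"
  have ss: "s \<bullet> s = 2 * e" and us: "u \<bullet> s = e" and ws: "w \<bullet> s = e"
    using uu by (simp_all add: s_def e_def inner_add inner_commute)
  have "s \<noteq> 0"
  proof
    assume "s = 0"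
    then have "w = - u" by (simp add: s_def eq_neg_iff_add_eq_0 add.commute)
    then show False using link linking_form_antidiag[OF u(1), of p d] \<open>d > 0\<close> by simp
  qed
  then have e: "e > 0" using ss by (metis inner_gt_zero_iff zero_less_mult_pos zero_less_numeral)
  \<comment> \<open>With \<open>k * e = d\<close> the apex \<open>x\<close> lies on both tangent
    hyperplanes.\<close>
  define k where "k = d / e"
  have k: "k > 0" "k * e = d" using e \<open>d > 0\<close> by (simp_all add: k_def)
  define x where "x = p + k *\<^sub>R s"
  define y where "y = p + d *\<^sub>R u"
  have "e * (x \<bullet> x - 1) = 2 * (k * e)\<^sup>2 + 2 * (k * e) * (p \<bullet> s) - (1 - p \<bullet> p) * e"
    using ss by (simp add: x_def inner_add inner_commute algebra_simps power2_eq_square)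
  also have "\<dots> = linking_form p d u w"
    using k by (simp add: linking_form_def s_def e_def)
  finally have "norm x = 1" using link e by (simp add: norm_eq_1)
  then obtain L where L: "symmetric_cone (solid_cone K x) x L" "p \<in> L"
    using sym[of x] by (auto simp: circumscribed_cone_symmetric_def)
  have px: "p - x = (- k) *\<^sub>R s" by (simp add: x_def)
  have "p \<noteq> x" using px k \<open>s \<noteq> 0\<close> by auto
  have "y \<in> solid_cone K x"
    unfolding solid_cone_def using u(2) by (intro CollectI exI[of _ y] exI[of _ 1]) (simp add: y_def)
  then have "x + reflect_in (p - x) (y - x) \<in> solid_cone K x"
    using symmetric_cone_reflect[OF L \<open>p \<noteq> x\<close>] by blast
  then obtain z t where z: "z \<in> K" "0 \<le> t" "reflect_in (p - x) (y - x) = t *\<^sub>R (z - x)"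
    unfolding solid_cone_def by auto
  have "reflect_in (p - x) (y - x) = reflect_in s (y - x)"
    unfolding px using k by (intro reflect_in_scaleR) simp
  also have "\<dots> = reflect_in s (d *\<^sub>R u + (- k) *\<^sub>R s)" by (simp add: y_def x_def)
  also have "\<dots> = d *\<^sub>R w + (- k) *\<^sub>R s"
    using reflect_in_add_swap[of u w] reflect_in_self_scaleR[of s 1] u w \<open>s \<noteq> 0\<close>
    unfolding reflect_in_linear by (simp add: s_def)
  finally have tz: "t *\<^sub>R (z - x) = d *\<^sub>R w - k *\<^sub>R s" using z(3) by simp
  \<comment> \<open>If \<open>t = 0\<close>, the image of \<open>y\<close>, hence \<open>y\<close>
    itself, would be the apex, which is outside \<open>K\<close>.\<close>
  have "t \<noteq> 0"
  proof
    assume "t = 0"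
    then have eq: "d *\<^sub>R w = k *\<^sub>R s" using tz by simp
    have "(d *\<^sub>R w) \<bullet> (d *\<^sub>R w) = (k *\<^sub>R s) \<bullet> (k *\<^sub>R s)" unfolding eq ..
    then have "d\<^sup>2 = 2 * k * (k * e)" using uu ss by (simp add: power2_eq_square)
    then have "d = 2 * k" using k \<open>d > 0\<close> by (simp add: power2_eq_square)
    have "(d *\<^sub>R u - k *\<^sub>R s) \<bullet> (d *\<^sub>R u - k *\<^sub>R s) = d\<^sup>2 - 2 * d * (k * e) + 2 * k * (k * e)"
      using uu ss us by (simp add: inner_diff inner_commute power2_eq_square algebra_simps)
    also have "\<dots> = 0" using k \<open>d = 2 * k\<close> by (simp add: power2_eq_square)
    finally have "y = x" by (simp add: y_def x_def)
    then show False using u(2) K1 \<open>norm x = 1\<close> by (auto simp: y_def)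
  qed
  \<comment> \<open>Pairing with \<open>w\<close> shows that \<open>z\<close> lies on the tangent
    hyperplane with normal \<open>w\<close>, as \<open>x\<close> does.\<close>
  have "t * ((z - x) \<bullet> w) = d - k * e"
    using arg_cong[OF tz, of "\<lambda>y. y \<bullet> w"] uu ws by (simp add: inner_diff inner_commute)
  then have "(z - x) \<bullet> w = 0" using k \<open>t \<noteq> 0\<close> by simp
  then have "(z - p) \<bullet> w = d"
    using ws k by (simp add: x_def inner_diff inner_add inner_commute)
  moreover have "norm (z - p) \<le> d" using z(1) Kd by (auto simp: dist_norm norm_minus_commute)
  ultimately have "z - p = d *\<^sub>R w" by (rule norm_le_inner_imp_eq[OF w])
  then have "z = p + d *\<^sub>R w" by (simp add: algebra_simps)
  then show ?thesis using z(1) by simp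
qed

theorem theorem2:
  fixes K :: "(real ^ 'n) set" and p :: "real ^ 'n"
  assumes "CARD('n) \<ge> 3"
    and "convex_body K"
    and "K \<subseteq> interior (cball 0 1)"
    and "\<And>x. x \<in> sphere 0 1 \<Longrightarrow> \<exists>L. circumscribed_cone_symmetric K x L \<and> p \<in> L"
  shows "\<exists>r>0. K = cball p r"
proof -
  have K: "compact K" "convex K" "interior K \<noteq> {}"
    using assms(2) by (auto simp: convex_body_def)
  have K1: "K \<subseteq> ball 0 1" using assms(3) by simp
  have "K \<noteq> {}" using K(3) by auto
  then obtain y where y: "y \<in> K" and ymax: "\<And>z. z \<in> K \<Longrightarrow> dist p z \<le> dist p y"
    using continuous_attains_sup[OF K(1) \<open>K \<noteq> {}\<close>
        continuous_on_dist[OF continuous_on_const[of K p] continuous_on_id]] by blast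
  define d where "d = dist p y"
  have Kd: "K \<subseteq> cball p d" using ymax by (auto simp: d_def)
  have "d > 0"
  proof (rule ccontr)
    assume "\<not> d > 0"
    then have "K \<subseteq> {p}" using Kd by (simp add: d_def)
    then have "interior K \<subseteq> interior {p}" by (rule interior_mono)
    then show False using K(3) by simp
  qed
  define M where "M = {u \<in> sphere 0 1. p + d *\<^sub>R u \<in> K}"
  have "M = sphere 0 1"
  proof (rule linking_closed_eq_sphere)
    show "DIM(real ^ 'n) \<ge> 3" using assms(1) by simp
    show "d \<noteq> 0" using \<open>d > 0\<close> by simp
    have "M = sphere 0 1 \<inter> (\<lambda>u. p + d *\<^sub>R u) -` K" by (auto simp: M_def)
    moreover have "closed ((\<lambda>u. p + d *\<^sub>R u) -` K)"
      using K(1) by (intro closed_vimage compact_imp_closed continuous_intros)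
    ultimately show "closed M" by auto
    show "M \<subseteq> sphere 0 1" by (auto simp: M_def)
    \<comment> \<open>The farthest point \<open>y\<close> supplies the first contact
      direction.\<close>
    have "(1 / d) *\<^sub>R (y - p) \<in> M"
      using y \<open>d > 0\<close> by (simp add: M_def) (simp add: d_def dist_norm norm_minus_commute)
    then show "M \<noteq> {}" by blast
    show "linking_form p d u u < 0" if "u \<in> M" for u
    proof -
      have "norm (p + d *\<^sub>R u) < 1" "norm u = 1" using that K1 by (auto simp: M_def)
      then show ?thesis by (simp add: linking_form_diag power2_eq_1_iff abs_square_less_1)
    qed
    show "w \<in> M" if "u \<in> M" "norm w = 1" "linking_form p d u w = 0" for u w
      using that linked_contact_point[OF \<open>d > 0\<close> K1 Kd assms(4), of u w] by (auto simp: M_def)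
  qed
  have "sphere p d \<subseteq> K"
  proof
    fix z assume "z \<in> sphere p d"
    then have "(1 / d) *\<^sub>R (z - p) \<in> M"
      using \<open>d > 0\<close> unfolding \<open>M = sphere 0 1\<close> by (simp add: dist_norm norm_minus_commute)
    then show "z \<in> K" using \<open>d > 0\<close> by (simp add: M_def)
  qed
  then have "convex hull (sphere p d) \<subseteq> K"
    using K(2) by (rule hull_minimal)
  \<comment> \<open>Krein-Milman recovers the ball from its bounding sphere.\<close>
  moreover have "cball p d = convex hull (sphere p d)"
    using Krein_Milman_frontier[of "cball p d"] by simp
  ultimately have "cball p d \<subseteq> K" by simp
  then show ?thesis using Kd \<open>d > 0\<close> by blast
qed

end
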